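(* Let $\mathscr{GP}=\mathscr{GP}(\Gamma,\mathcal{M})$ be a graph product of monoids. Let $w\in X^*$ and let $w_1\circ w_2\circ\cdots\circ w_k$ and $w_1'\circ w_2'\circ\cdots\circ w_h'$ be left Foata normal forms of $w$ with blocks $w_i$ ($1\le i\le k$) and $w_j'$ ($1\le j\le h$), respectively. Then $k=h$ and $[w_i]=[w_i']$ for all $1\le i\le k$.
   Context: Graph products: $\Gamma=\Gamma(V,E)$ is a simple undirected graph without loops, with vertex set $V$ (possibly infinite), $|V|\ge 2$, and edge set $E$ a set of $2$-element subsets of $V$; write $(\alpha,\beta)\in E$ for $\{\alpha,\beta\}\in E$ (so $(\alpha,\alpha)\notin E$). $\mathcal{M}=\{M_\alpha:\alpha\in V\}$ is a set of mutually disjoint monoids, $1_\alpha$ is the identity of $M_\alpha$, $I=\{1_\alpha:\alpha\in V\}$, $X=\bigcup_{\alpha\in V}M_\alpha$. $X^*$ is the free monoid on $X$, with juxtaposition $\circ$ and empty word $\epsilon$. $\mathscr{GP}=X^*/R^\sharp$, where $R^\sharp$ is the congruence generated by: $1_\alpha=\epsilon$ ($\alpha\in V$); $x\circ y=xy$ ($x,y\in M_\alpha$, $\alpha\in V$); $x\circ y=y\circ x$ ($x\in M_\alpha$, $y\in M_\beta$, $(\alpha,\beta)\in E$). $[w]$ denotes the class of $w\in X^*$ in $\mathscr{GP}$. Support: for $a\in M_\alpha$, $s(a)=\alpha$; for a word $x=x_1\circ\cdots\circ x_n$ with $x_i\in X$, $s(x)=\{s(x_i):1\le i\le n\}$, and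 $s(\epsilon)=\emptyset$. Reduced words: $x_1\circ\cdots\circ x_n\in X^*$ ($x_i\in X$) is reduced if no $x_i$ lies in $I$ and whenever $i<j$ and $s(x_i)=s(x_j)$, there is $k$ with $i<k<j$ and $(s(x_i),s(x_k))\notin E$. Left Foata normal form: a word $w\in X^*$ is a left Foata normal form with block length $k$ and (non-empty) blocks $w_1,\dots,w_k\in X^*$ if (i) $w=w_1\circ\cdots\circ w_k$ is reduced; (ii) $s(w_i)$ is a complete subgraph of $\Gamma$ (any two distinct vertices are adjacent) for all $i$; (iii) for any $1\le i<k$ and $\alpha\in s(w_{i+1})$ there is $\beta\in s(w_i)$ with $(\alpha,\beta)\notin E$. The empty word is a left Foata normal form with block length $0$. A left Foata normal form of $x\in X^*$ is a left Foata normal form $w$ with $[w]=[x]$. *)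

theory Defs
  imports "HOL-Algebra.Group" "HOL-Library.Disjoint_Sets"
begin

text \<open>
  The vertex monoids live in one ambient type and have pairwise disjoint carriers, so that words
  over their union are plain lists. An edge between \<open>\<alpha>\<close> and \<open>\<beta>\<close> is the
  set \<open>{\<alpha>, \<beta>}\<close>; since edges have two elements, \<open>{\<alpha>, \<alpha>}\<close> is never
  an edge.
\<close>

locale graph_product =
  fixes V :: "'v set"
    and E :: "'v set set"
    and M :: "'v \<Rightarrow> ('a, 'b) monoid_scheme"
  assumes edges: "\<forall>e\<in>E. e \<subseteq> V \<and> card e = 2"
    and two_vertices: "\<exists>\<alpha>\<in>V. \<exists>\<beta>\<in>V. \<alpha> \<noteq> \<beta>"
    and monoids: "\<forall>\<alpha>\<in>V. monoid (M \<alpha>)"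
    and disjoint: "disjoint_family_on (\<lambda>\<alpha>. carrier (M \<alpha>)) V"
begin

definition letters :: "'a set" where
  "letters = (\<Union>\<alpha>\<in>V. carrier (M \<alpha>))"

definition identities :: "'a set" where
  "identities = {\<one>\<^bsub>M \<alpha>\<^esub> | \<alpha>. \<alpha> \<in> V}"

definition words :: "'a list set" where
  "words = lists letters"

definition relators :: "('a list \<times> 'a list) set" where
  "relators =
     {([\<one>\<^bsub>M \<alpha>\<^esub>], []) | \<alpha>. \<alpha> \<in> V}
   \<union> {([x, y], [x \<otimes>\<^bsub>M \<alpha>\<^esub> y]) | \<alpha> x y.
        \<alpha> \<in> V \<and> x \<in> carrier (M \<alpha>) \<and> y \<in> carrier (M \<alpha>)}
   \<union> {([x, y], [y, x]) | \<alpha> \<beta> x y.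
        \<alpha> \<in> V \<and> \<beta> \<in> V \<and> {\<alpha>, \<beta>} \<in> E \<and> x \<in> carrier (M \<alpha>) \<and> y \<in> carrier (M \<beta>)}"

definition is_congruence :: "('a list \<times> 'a list) set \<Rightarrow> bool" where
  "is_congruence r \<longleftrightarrow>
     equiv words r \<and>
     (\<forall>u u' v v'. (u, u') \<in> r \<longrightarrow> (v, v') \<in> r \<longrightarrow> (u @ v, u' @ v') \<in> r)"

definition cong_gen :: "('a list \<times> 'a list) set" where
  "cong_gen = \<Inter> {r. is_congruence r \<and> relators \<subseteq> r}"

definition GP :: "'a list set monoid" where
  "GP = \<lparr> carrier = words // cong_gen,
          mult = (\<lambda>A B. \<Union>u\<in>A. \<Union>v\<in>B. cong_gen `` {u @ v}),
          one = cong_gen `` {[]} \<rparr>"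

definition cls :: "'a list \<Rightarrow> 'a list set" where
  "cls w = cong_gen `` {w}"

text \<open>Only meaningful for \<open>a \<in> letters\<close>, where the vertex is unique by disjointness.\<close>

definition letter_supp :: "'a \<Rightarrow> 'v" where
  "letter_supp a = (THE \<alpha>. \<alpha> \<in> V \<and> a \<in> carrier (M \<alpha>))"

definition supp :: "'a list \<Rightarrow> 'v set" where
  "supp w = letter_supp ` set w"

definition reduced :: "'a list \<Rightarrow> bool" where
  "reduced x \<longleftrightarrow>
     x \<in> words \<and>
     (\<forall>i<length x. x ! i \<notin> identities) \<and>
     (\<forall>i j. i < j \<longrightarrow> j < length x \<longrightarrow> letter_supp (x ! i) = letter_supp (x ! j) \<longrightarrow>
        (\<exists>k. i < k \<and> k < j \<and> {letter_supp (x ! i), letter_supp (x ! k)} \<notin> E))"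

definition complete :: "'v set \<Rightarrow> bool" where
  "complete S \<longleftrightarrow> S \<subseteq> V \<and> (\<forall>\<alpha>\<in>S. \<forall>\<beta>\<in>S. \<alpha> \<noteq> \<beta> \<longrightarrow> {\<alpha>, \<beta>} \<in> E)"

text \<open>
  The word \<open>w\<close> is a left Foata normal form with list of blocks \<open>ws\<close>; its block
  length is \<open>length ws\<close>. The case \<open>ws = []\<close> is the empty word with block length 0.
\<close>

definition left_foata :: "'a list \<Rightarrow> 'a list list \<Rightarrow> bool" where
  "left_foata w ws \<longleftrightarrow>
     [] \<notin> set ws \<and> w = concat ws \<and> reduced w \<and>
     (\<forall>i<length ws. complete (supp (ws ! i))) \<and>
     (\<forall>i. Suc i < length ws \<longrightarrow>
        (\<forall>\<alpha>\<in>supp (ws ! Suc i). \<exists>\<beta>\<in>supp (ws ! i). {\<alpha>, \<beta>} \<notin> E))"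

definition left_foata_of :: "'a list \<Rightarrow> 'a list \<Rightarrow> 'a list list \<Rightarrow> bool" where
  "left_foata_of x w ws \<longleftrightarrow> left_foata w ws \<and> cls w = cls x"

lemma letter_supp_eqI:
  assumes "\<alpha> \<in> V" "a \<in> carrier (M \<alpha>)"
  shows "letter_supp a = \<alpha>"
  unfolding letter_supp_def
  using assms disjoint by (auto simp: disjoint_family_on_def intro!: the_equality)

lemma relators_subset: "relators \<subseteq> words \<times> words"
proof
  fix p assume "p \<in> relators"
  then consider
      (one) \<alpha> where "\<alpha> \<in> V" "p = ([\<one>\<^bsub>M \<alpha>\<^esub>], [])"
    | (mult) \<alpha> x y where "\<alpha> \<in> V" "x \<in> carrier (M \<alpha>)" "y \<in> carrier (M \<alpha>)"
        "p = ([x, y], [x \<otimes>\<^bsub>M \<alpha>\<^esub> y])"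
    | (comm) \<alpha> \<beta> x y where "\<alpha> \<in> V" "\<beta> \<in> V" "x \<in> carrier (M \<alpha>)" "y \<in> carrier (M \<beta>)"
        "p = ([x, y], [y, x])"
    unfolding relators_def by blast
  then show "p \<in> words \<times> words"
  proof cases
    case one
    then have "monoid (M \<alpha>)"
      using monoids by simp
    then have "\<one>\<^bsub>M \<alpha>\<^esub> \<in> letters"
      unfolding letters_def by (intro UN_I[OF one(1)] monoid.one_closed)
    then show ?thesis using one by (simp add: words_def)
  next
    case mult
    then have "monoid (M \<alpha>)"
      using monoids by simp
    then have "x \<otimes>\<^bsub>M \<alpha>\<^esub> y \<in> letters"
      unfolding letters_def by (intro UN_I[OF mult(1)] monoid.m_closed mult)
    moreover have "x \<in> letters"
      unfolding letters_def by (rule UN_I[OF mult(1)], rule mult)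
    moreover have "y \<in> letters"
      unfolding letters_def by (rule UN_I[OF mult(1)], rule mult)
    ultimately
    show ?thesis using mult by (simp add: words_def)
  next
    case comm
    have "x \<in> letters"
      unfolding letters_def by (rule UN_I[OF comm(1)], rule comm)
    moreover have "y \<in> letters"
      unfolding letters_def by (rule UN_I[OF comm(2)], rule comm)
    ultimately show ?thesis using comm by (simp add: words_def)
  qed
qed

lemma is_congruence_full: "is_congruence (words \<times> words)"
proof -
  have "equiv words (words \<times> words)"
    by (rule equivI) (auto intro!: refl_onI symI transI)
  moreover have "u @ v \<in> words" if "u \<in> words" "v \<in> words" for u v
    using that by (simp add: words_def)
  ultimately show ?thesis
    unfolding is_congruence_def by blast
qed

lemma is_congruence_cong_gen: "is_congruence cong_gen"
proof -
  let ?C = "{r. is_congruence r \<and> relators \<subseteq> r}"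
  have full: "words \<times> words \<in> ?C"
    using is_congruence_full relators_subset by simp
  have sub: "cong_gen \<subseteq> words \<times> words"
    unfolding cong_gen_def using full by blast
  have eq: "equiv words r" if "r \<in> ?C" for r
    using that unfolding is_congruence_def by blast
  have "equiv words cong_gen"
  proof (rule equivI)
    show "cong_gen \<subseteq> words \<times> words" by (rule sub)
    show "refl_on words cong_gen"
    proof (rule refl_onI)
      fix x assume "x \<in> words"
      then have "(x, x) \<in> r" if "r \<in> ?C" for r
        using eq[OF that] by (simp add: equiv_def refl_on_def)
      then show "(x, x) \<in> cong_gen" unfolding cong_gen_def by (rule InterI)
    qed
    show "sym cong_gen"
    proof (rule symI)
      fix x y assume xy: "(x, y) \<in> cong_gen"
      have "(y, x) \<in> r" if "r \<in> ?C" for r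
      proof -
        have "(x, y) \<in> r" using xy that unfolding cong_gen_def by (rule InterD)
        then show ?thesis using eq[OF that] by (meson equivE symD)
      qed
      then show "(y, x) \<in> cong_gen" unfolding cong_gen_def by (rule InterI)
    qed
    show "trans cong_gen"
    proof (rule transI)
      fix x y z assume xy: "(x, y) \<in> cong_gen" and yz: "(y, z) \<in> cong_gen"
      have "(x, z) \<in> r" if "r \<in> ?C" for r
      proof -
        have "(x, y) \<in> r" using xy that unfolding cong_gen_def by (rule InterD)
        moreover have "(y, z) \<in> r" using yz that unfolding cong_gen_def by (rule InterD)
        ultimately show ?thesis using eq[OF that] by (meson equivE transD)
      qed
      then show "(x, z) \<in> cong_gen" unfolding cong_gen_def by (rule InterI)
    qed
  qed
  moreover have "(u @ v, u' @ v') \<in> cong_gen"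
    if "(u, u') \<in> cong_gen" "(v, v') \<in> cong_gen" for u u' v v'
  proof -
    have "(u @ v, u' @ v') \<in> r" if r: "r \<in> ?C" for r
    proof -
      have "(u, u') \<in> r" "(v, v') \<in> r"
        using \<open>(u, u') \<in> cong_gen\<close> \<open>(v, v') \<in> cong_gen\<close> r
        unfolding cong_gen_def by blast+
      then show ?thesis
        using r unfolding is_congruence_def by blast
    qed
    then show ?thesis unfolding cong_gen_def by (rule InterI)
  qed
  ultimately show ?thesis
    unfolding is_congruence_def by blast
qed

lemma cls_in_GP: "w \<in> words \<Longrightarrow> cls w \<in> carrier GP"
  by (simp add: GP_def cls_def quotientI)

lemma cls_append:
  assumes "u \<in> words" "v \<in> words"
  shows "cls u \<otimes>\<^bsub>GP\<^esub> cls v = cls (u @ v)"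
proof -
  have eq: "equiv words cong_gen"
    and app: "\<And>u u' v v'. (u, u') \<in> cong_gen \<Longrightarrow> (v, v') \<in> cong_gen \<Longrightarrow> (u @ v, u' @ v') \<in> cong_gen"
    using is_congruence_cong_gen unfolding is_congruence_def by blast+
  have const: "cong_gen `` {u' @ v'} = cong_gen `` {u @ v}"
    if "u' \<in> cls u" "v' \<in> cls v" for u' v'
    using equiv_class_eq[OF eq app[of u u' v v']] that by (simp add: cls_def)
  have self: "u \<in> cls u" "v \<in> cls v"
    using assms equiv_class_self[OF eq] by (auto simp: cls_def)
  have "cls u \<otimes>\<^bsub>GP\<^esub> cls v = (\<Union>u'\<in>cls u. \<Union>v'\<in>cls v. cong_gen `` {u' @ v'})"
    by (simp add: GP_def)
  also have "\<dots> = (\<Union>u'\<in>cls u. \<Union>v'\<in>cls v. cong_gen `` {u @ v})"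
    by (intro SUP_cong refl const)
  also have "\<dots> = cong_gen `` {u @ v}"
    using self by blast
  finally show ?thesis
    by (simp add: cls_def)
qed

end

end

theory Submission
  imports Defs
begin

text \<open>
  Letting a letter act on reduced words by left multiplication followed by reduction respects the
  defining relations up to shuffling of commuting letters. Hence congruent reduced words are
  shuffles of each other. The first block of a left Foata normal form consists exactly of the
  letters that can be shuffled to the front, a set that is invariant under shuffling; cancelling
  the first block and inducting on the block length gives uniqueness.
\<close>

context graph_product
begin

section \<open>Edges, letters and identities\<close>

lemma edge_irrefl: "{\<alpha>, \<alpha>} \<notin> E"
  using edges by force

lemma edge_sym: "{\<alpha>, \<beta>} \<in> E \<longleftrightarrow> {\<beta>, \<alpha>} \<in> E"
  by (simp add: insert_commute)

lemma letter_suppD: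
  assumes "x \<in> letters"
  shows "letter_supp x \<in> V" "x \<in> carrier (M (letter_supp x))"
  using assms letter_supp_eqI unfolding letters_def by auto

lemma lettersI: "\<alpha> \<in> V \<Longrightarrow> x \<in> carrier (M \<alpha>) \<Longrightarrow> x \<in> letters"
  by (auto simp: letters_def)

lemma one_in_carrier: "\<alpha> \<in> V \<Longrightarrow> \<one>\<^bsub>M \<alpha>\<^esub> \<in> carrier (M \<alpha>)"
  using monoids by (simp add: monoid.one_closed)

text \<open>Disjointness of the carriers rules out that \<open>x\<close> is the identity of some
  other vertex monoid.\<close>

lemma identities_iff:
  assumes "\<alpha> \<in> V" "x \<in> carrier (M \<alpha>)"
  shows "x \<in> identities \<longleftrightarrow> x = \<one>\<^bsub>M \<alpha>\<^esub>"
proof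
  assume "x \<in> identities"
  then obtain \<beta> where \<beta>: "\<beta> \<in> V" "x = \<one>\<^bsub>M \<beta>\<^esub>"
    by (auto simp: identities_def)
  then have "\<alpha> = \<beta>"
    using letter_supp_eqI[OF assms] letter_supp_eqI[of \<beta> x] one_in_carrier by simp
  then show "x = \<one>\<^bsub>M \<alpha>\<^esub>"
    using \<beta> by simp
qed (use assms in \<open>auto simp: identities_def\<close>)

section \<open>Shuffling of commuting letters\<close>

text \<open>This is trace equivalence (partial commutation). No rule for symmetry is given: edges
  are unordered pairs, so every swap can be undone by a swap.\<close>

inductive shuffle :: "'a list \<Rightarrow> 'a list \<Rightarrow> bool" where
  Nil: "shuffle [] []"
| swap: "{letter_supp x, letter_supp y} \<in> E \<Longrightarrow> shuffle (x # y # w) (y # x # w)"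
| Cons: "shuffle u v \<Longrightarrow> shuffle (x # u) (x # v)"
| trans: "shuffle u v \<Longrightarrow> shuffle v w \<Longrightarrow> shuffle u w"

lemma shuffle_refl [simp]: "shuffle w w"
  by (induction w) (simp_all add: shuffle.Nil shuffle.Cons)

lemma shuffle_sym: "shuffle u v \<Longrightarrow> shuffle v u"
  by (induction rule: shuffle.induct)
    (simp_all add: shuffle.Cons shuffle.swap edge_sym, rule shuffle.trans)

lemma shuffle_append_right: "shuffle u v \<Longrightarrow> shuffle (u @ p) (v @ p)"
  by (induction rule: shuffle.induct)
    (simp_all add: shuffle.Cons shuffle.swap, rule shuffle.trans)

lemma shuffle_length: "shuffle u v \<Longrightarrow> length u = length v"
  by (induction rule: shuffle.induct) auto

text \<open>Deleting the first occurrence of a letter turns a swap either into a swap or into an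
  equality. This gives cancellation although letters need not be invertible.\<close>

lemma shuffle_remove1: "shuffle u v \<Longrightarrow> shuffle (remove1 x u) (remove1 x v)"
  by (induction rule: shuffle.induct)
    (auto simp: shuffle.Cons shuffle.swap elim: shuffle.trans)

text \<open>The head of a common prefix is the first occurrence of its letter in both words, so
  \<open>remove1\<close> strips it from both.\<close>

lemma shuffle_append_cancel: "shuffle (p @ u) (p @ v) \<Longrightarrow> shuffle u v"
proof (induction p)
  case (Cons x p)
  then show ?case using shuffle_remove1[OF Cons.prems, of x] by simp
qed simp

lemma shuffle_move_to_front:
  "\<forall>y\<in>set p. {letter_supp x, letter_supp y} \<in> E \<Longrightarrow> shuffle (p @ x # q) (x # p @ q)"
proof (induction p)
  case (Cons y p)
  then have "shuffle (y # p @ x # q) (y # x # p @ q)"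
    by (auto intro: shuffle.Cons)
  moreover have "shuffle (y # x # p @ q) (x # y # p @ q)"
    using Cons.prems by (intro shuffle.swap) (simp add: edge_sym)
  ultimately show ?case by (auto intro: shuffle.trans)
qed simp

text \<open>The head of \<open>u\<close> occurs in \<open>v\<close> and commutes with everything
  before it; distinctness keeps a second copy from standing in its way.\<close>

lemma shuffle_if_commuting:
  "distinct u \<Longrightarrow> distinct v \<Longrightarrow> set u = set v \<Longrightarrow>
   \<forall>x\<in>set u. \<forall>y\<in>set u. x \<noteq> y \<longrightarrow> {letter_supp x, letter_supp y} \<in> E \<Longrightarrow> shuffle u v"
proof (induction u arbitrary: v)
  case (Cons x u)
  then obtain p q where v: "v = p @ x # q"
    by (metis list.set_intros(1) split_list)
  have "set u = set (p @ q)"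
    using Cons.prems(1-3) v by auto
  moreover have "distinct u" "distinct (p @ q)"
    using Cons.prems(1,2) v by auto
  ultimately have "shuffle u (p @ q)"
    using Cons.prems(4) by (intro Cons.IH) auto
  moreover have "set p \<subseteq> set (x # u)" "x \<notin> set p"
    using Cons.prems(2,3) v by auto
  then have "shuffle v (x # p @ q)"
    unfolding v using Cons.prems(4) by (intro shuffle_move_to_front) (metis list.set_intros(1) subsetD)
  ultimately show ?case
    by (meson shuffle.Cons shuffle.trans shuffle_sym)
qed simp

section \<open>The generated congruence\<close>

lemma cong_gen_append:
  "(u, u') \<in> cong_gen \<Longrightarrow> (v, v') \<in> cong_gen \<Longrightarrow> (u @ v, u' @ v') \<in> cong_gen"
  using is_congruence_cong_gen unfolding is_congruence_def by blast

lemma equiv_cong_gen: "equiv words cong_gen"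
  using is_congruence_cong_gen unfolding is_congruence_def by blast

lemma cong_gen_refl: "w \<in> words \<Longrightarrow> (w, w) \<in> cong_gen"
  using equiv_cong_gen by (meson equivE refl_onD)

lemma relators_cong_gen: "relators \<subseteq> cong_gen"
  unfolding cong_gen_def by blast

text \<open>A swap is a commutation relator in context. Membership in \<open>words\<close> is
  carried along because the transitive case needs it for the middle word.\<close>

lemma shuffle_cong_gen: "shuffle u v \<Longrightarrow> u \<in> words \<Longrightarrow> v \<in> words \<and> (u, v) \<in> cong_gen"
proof (induction rule: shuffle.induct)
  case Nil
  then show ?case using cong_gen_refl by blast
next
  case (swap x y w)
  then have xy: "x \<in> letters" "y \<in> letters" and w: "w \<in> words"
    by (auto simp: words_def)
  have "([x, y], [y, x]) \<in> relators"
    unfolding relators_def using letter_suppD xy swap.hyps by blast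
  then have "([x, y] @ w, [y, x] @ w) \<in> cong_gen"
    using relators_cong_gen cong_gen_refl[OF w] by (blast intro: cong_gen_append)
  then show ?case using xy w by (simp add: words_def)
next
  case (Cons u v x)
  then have "x \<in> letters" "v \<in> words" "(u, v) \<in> cong_gen"
    by (auto simp: words_def)
  then show ?case
    using cong_gen_append[OF cong_gen_refl[of "[x]"]] by (fastforce simp: words_def)
next
  case (trans u v w)
  then show ?case using equiv_cong_gen by (meson equivE transD)
qed

section \<open>Exposed vertices and irreducible words\<close>

text \<open>The first letter at \<alpha> can be shuffled to the front, so that a new letter at
  \<alpha> placed before the word could be merged with it.\<close>

fun exposed :: "'v \<Rightarrow> 'a list \<Rightarrow> bool" where
  "exposed \<alpha> [] \<longleftrightarrow> False"
| "exposed \<alpha> (y # w) \<longleftrightarrow>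
     letter_supp y = \<alpha> \<or> ({\<alpha>, letter_supp y} \<in> E \<and> exposed \<alpha> w)"

text \<open>A recursive counterpart of \<open>reduced\<close>: each letter is compared with its tail
  only, which suits inductions on words.\<close>

fun irreducible_word :: "'a list \<Rightarrow> bool" where
  "irreducible_word [] \<longleftrightarrow> True"
| "irreducible_word (x # w) \<longleftrightarrow>
     x \<in> letters \<and> x \<notin> identities \<and> \<not> exposed (letter_supp x) w \<and> irreducible_word w"

lemma exposedD:
  "exposed \<alpha> w \<Longrightarrow>
     \<exists>j<length w. letter_supp (w ! j) = \<alpha> \<and> (\<forall>k<j. {\<alpha>, letter_supp (w ! k)} \<in> E)"
proof (induction w)
  case (Cons y w)
  show ?case
  proof (cases "letter_supp y = \<alpha>")
    case True
    then show ?thesis by (intro exI[of _ 0]) simp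
  next
    case False
    then obtain j where j: "j < length w" "letter_supp (w ! j) = \<alpha>"
        "\<forall>k<j. {\<alpha>, letter_supp (w ! k)} \<in> E" and y: "{\<alpha>, letter_supp y} \<in> E"
      using Cons by auto
    then have "\<forall>k<Suc j. {\<alpha>, letter_supp ((y # w) ! k)} \<in> E"
      by (auto simp: less_Suc_eq_0_disj)
    then show ?thesis using j by (intro exI[of _ "Suc j"]) simp
  qed
qed simp

lemma reduced_appendD2:
  assumes "reduced (u @ v)"
  shows "reduced v"
  unfolding reduced_def
proof (intro conjI allI impI)
  show "v \<in> words" using assms by (auto simp: reduced_def words_def)
  show "v ! i \<notin> identities" if "i < length v" for i
    using assms that unfolding reduced_def by (auto dest!: spec[of _ "length u + i"])
  fix i j assume ij: "i < j" "j < length v" "letter_supp (v ! i) = letter_supp (v ! j)"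
  let ?n = "length u"
  obtain k where k: "?n + i < k" "k < ?n + j"
      "{letter_supp ((u @ v) ! (?n + i)), letter_supp ((u @ v) ! k)} \<notin> E"
    using assms ij unfolding reduced_def
    by (metis add_less_cancel_left length_append nth_append_length_plus)
  \<comment> \<open>The obstruction lies strictly between two positions of \<open>v\<close>, so it
    is itself a position of \<open>v\<close> once the shift by \<open>?n\<close> is undone.\<close>
  then have "i < k - ?n" "k - ?n < j" "(u @ v) ! k = v ! (k - ?n)"
    by (auto simp: nth_append)
  then show "\<exists>k. i < k \<and> k < j \<and> {letter_supp (v ! i), letter_supp (v ! k)} \<notin> E"
    using k(3) by (metis nth_append_length_plus)
qed

lemma reduced_appendD1:
  assumes "reduced (u @ v)"
  shows "reduced u"
  unfolding reduced_def
proof (intro conjI allI impI)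
  show "u \<in> words" using assms by (auto simp: reduced_def words_def)
  show "u ! i \<notin> identities" if "i < length u" for i
    using assms that unfolding reduced_def by (metis length_append nth_append trans_less_add1)
  fix i j assume ij: "i < j" "j < length u" "letter_supp (u ! i) = letter_supp (u ! j)"
  then have "j < length (u @ v)" "letter_supp ((u @ v) ! i) = letter_supp ((u @ v) ! j)"
    by (auto simp: nth_append)
  then obtain k where "i < k" "k < j"
      "{letter_supp ((u @ v) ! i), letter_supp ((u @ v) ! k)} \<notin> E"
    using assms ij(1) unfolding reduced_def by blast
  then show "\<exists>k. i < k \<and> k < j \<and> {letter_supp (u ! i), letter_supp (u ! k)} \<notin> E"
    using ij by (intro exI[of _ k]) (simp add: nth_append)
qed

lemma reduced_imp_irreducible_word: "reduced w \<Longrightarrow> irreducible_word w"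
proof (induction w)
  case (Cons x w)
  have "reduced w"
    using reduced_appendD2[of "[x]" w] Cons.prems by simp
  moreover have "x \<in> letters" "x \<notin> identities"
    using Cons.prems unfolding reduced_def words_def by auto
  moreover have "\<not> exposed (letter_supp x) w"
  proof
    assume "exposed (letter_supp x) w"
    then obtain j where j: "j < length w" "letter_supp (w ! j) = letter_supp x"
        "\<forall>k<j. {letter_supp x, letter_supp (w ! k)} \<in> E"
      using exposedD by blast
    \<comment> \<open>Reducedness is applied to the positions 0 and \<open>Suc j\<close> of
      \<open>x # w\<close>; the obstruction it yields contradicts exposure.\<close>
    then obtain k where k: "0 < k" "k < Suc j"
        "{letter_supp ((x # w) ! 0), letter_supp ((x # w) ! k)} \<notin> E"
      using Cons.prems unfolding reduced_def
      by (metis Suc_less_eq length_Cons nth_Cons_0 nth_Cons_Suc zero_less_Suc)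
    then show False using j(3) by (cases k) auto
  qed
  ultimately show ?case using Cons.IH by simp
qed simp

section \<open>Letters acting on irreducible words\<close>

text \<open>
  A letter that meets neither its own vertex nor an obstruction ends up at the end of the word:
  up to shuffling this is the same as putting it at the front.
\<close>

fun insert_letter :: "'a \<Rightarrow> 'a list \<Rightarrow> 'a list" where
  "insert_letter x [] = [x]"
| "insert_letter x (y # w) =
     (if letter_supp y = letter_supp x
      then (let z = x \<otimes>\<^bsub>M (letter_supp x)\<^esub> y in if z \<in> identities then w else z # w)
      else if {letter_supp x, letter_supp y} \<in> E then y # insert_letter x w
      else x # y # w)"

text \<open>Identities act trivially, which keeps them out of the words and makes the action respect
  the relators that erase identities.\<close>

definition act :: "'a \<Rightarrow> 'a list \<Rightarrow> 'a list" where
  "act x w = (if x \<in> identities then w else insert_letter x w)"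

lemma mult_letter:
  assumes "x \<in> letters" "y \<in> letters" "letter_supp y = letter_supp x"
  shows "x \<otimes>\<^bsub>M (letter_supp x)\<^esub> y \<in> letters"
    "letter_supp (x \<otimes>\<^bsub>M (letter_supp x)\<^esub> y) = letter_supp x"
proof -
  have "x \<otimes>\<^bsub>M (letter_supp x)\<^esub> y \<in> carrier (M (letter_supp x))"
    using assms monoids letter_suppD by (metis monoid.m_closed)
  then show "x \<otimes>\<^bsub>M (letter_supp x)\<^esub> y \<in> letters"
    "letter_supp (x \<otimes>\<^bsub>M (letter_supp x)\<^esub> y) = letter_supp x"
    using assms letter_suppD lettersI letter_supp_eqI by blast+
qed

text \<open>Insertion adds, replaces or deletes a single letter at the vertex of \<open>x\<close>.
  Being at a neighbour of \<beta>, that letter neither witnesses nor blocks exposure of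
  \<beta>.\<close>

lemma exposed_insert_letter:
  assumes "{\<beta>, letter_supp x} \<in> E" "x \<in> letters" "irreducible_word w"
  shows "exposed \<beta> (insert_letter x w) \<longleftrightarrow> exposed \<beta> w"
  using assms(3)
proof (induction w)
  case Nil
  then show ?case using assms(1) edge_irrefl by auto
next
  case (Cons y w)
  have ne: "letter_supp x \<noteq> \<beta>"
    using assms(1) edge_irrefl by auto
  show ?case
    using Cons ne assms mult_letter(2)[of x y] by (auto simp: Let_def)
qed

lemma irreducible_insert_letter:
  assumes "x \<in> letters" "x \<notin> identities" "irreducible_word w"
  shows "irreducible_word (insert_letter x w)"
  using assms(3)
proof (induction w)
  case (Cons y w)
  then show ?case
    using assms mult_letter[of x y] exposed_insert_letter[of "letter_supp y" x w]
    by (auto simp: Let_def edge_sym)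
qed (use assms in simp)

lemma irreducible_act: "x \<in> letters \<Longrightarrow> irreducible_word w \<Longrightarrow> irreducible_word (act x w)"
  by (simp add: act_def irreducible_insert_letter)

text \<open>Without an exposed letter at its vertex, \<open>x\<close> never merges. It only passes
  neighbours, and can be moved back past them.\<close>

lemma shuffle_insert_letter_Cons:
  "\<not> exposed (letter_supp x) w \<Longrightarrow> shuffle (insert_letter x w) (x # w)"
proof (induction w)
  case (Cons y w)
  show ?case
  proof (cases "{letter_supp x, letter_supp y} \<in> E")
    case True
    then have "shuffle (y # insert_letter x w) (y # x # w)"
      using Cons by (auto intro: shuffle.Cons)
    moreover have "shuffle (y # x # w) (x # y # w)"
      using True by (intro shuffle.swap) (simp add: edge_sym)
    ultimately show ?thesis
      using Cons.prems True by (auto intro: shuffle.trans)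
  qed (use Cons.prems in auto)
qed simp

lemma shuffle_insert_letter:
  "shuffle u v \<Longrightarrow> u \<in> words \<Longrightarrow> x \<in> letters \<Longrightarrow>
   shuffle (insert_letter x u) (insert_letter x v)"
proof (induction rule: shuffle.induct)
  case (swap y z w)
  let ?a = "letter_supp x" and ?b = "letter_supp y" and ?c = "letter_supp z"
  have ne: "?b \<noteq> ?c" and zy: "{?c, ?b} \<in> E" and yz: "y \<in> letters" "z \<in> letters"
    using swap edge_irrefl edge_sym by (auto simp: words_def)
  consider "?b = ?a" | "?c = ?a" | "?b \<noteq> ?a" "?c \<noteq> ?a" by blast
  then show ?case
  proof cases
    case 1
    then show ?thesis
      using swap ne yz zy mult_letter(2)[of x y]
      by (auto simp: Let_def intro: shuffle.swap)
  next
    case 2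
    then show ?thesis
      using swap ne yz zy mult_letter(2)[of x z]
      by (auto simp: Let_def intro: shuffle.swap)
  next
    \<comment> \<open>The outcome depends on which of \<open>y\<close> and \<open>z\<close> the
      letter \<open>x\<close> can pass; the three shuffles below connect the results in every
      combination.\<close>
    case 3
    have "shuffle (x # y # z # w) (x # z # y # w)"
      using swap by (intro shuffle.Cons shuffle.swap)
    moreover have "shuffle (y # x # z # w) (x # y # z # w)" if "{?a, ?b} \<in> E"
      using that by (intro shuffle.swap) (simp add: edge_sym)
    moreover have "shuffle (x # z # y # w) (z # x # y # w)" if "{?a, ?c} \<in> E"
      using that by (intro shuffle.swap)
    ultimately show ?thesis using 3 swap
      by (auto intro: shuffle.swap) (meson shuffle.trans)+
  qed
next
  case (trans u v w)
  then show ?case using shuffle_cong_gen by (meson shuffle.trans)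
qed (auto simp: Let_def words_def intro: shuffle.Cons)

lemma irreducible_imp_words: "irreducible_word w \<Longrightarrow> w \<in> words"
  by (induction w) (auto simp: words_def)

lemma shuffle_act:
  "shuffle u v \<Longrightarrow> u \<in> words \<Longrightarrow> x \<in> letters \<Longrightarrow> shuffle (act x u) (act x v)"
  by (simp add: act_def shuffle_insert_letter)

text \<open>Associativity in one vertex monoid. Equality can fail: if \<open>y\<close> cancels an
  exposed letter, \<open>x\<close> drifts on into the tail, while the product leaves
  \<open>x\<close> where that letter stood.\<close>

lemma insert_letter_mult:
  assumes "x \<in> letters" "x \<notin> identities" "y \<in> letters" "y \<notin> identities"
    and eq: "letter_supp y = letter_supp x" and "irreducible_word w"
  shows "shuffle (insert_letter x (insert_letter y w)) (act (x \<otimes>\<^bsub>M (letter_supp x)\<^esub> y) w)"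
  using assms(6)
proof (induction w)
  case Nil
  then show ?case using assms by (simp add: act_def Let_def)
next
  case (Cons z w)
  define \<alpha> where "\<alpha> = letter_supp x"
  interpret m: monoid "M \<alpha>"
    using monoids letter_suppD assms(1) \<alpha>_def by blast
  have x: "letter_supp x = \<alpha>" "x \<in> carrier (M \<alpha>)"
    and y: "letter_supp y = \<alpha>" "y \<in> carrier (M \<alpha>)" and \<alpha>: "\<alpha> \<in> V"
    using assms(3) letter_suppD[OF assms(1)] letter_suppD(2)[OF assms(3)] eq \<alpha>_def by auto
  have xy: "x \<otimes>\<^bsub>M \<alpha>\<^esub> y \<in> letters" "letter_supp (x \<otimes>\<^bsub>M \<alpha>\<^esub> y) = \<alpha>"
    using mult_letter[of x y] assms \<alpha>_def by auto
  have z: "z \<in> letters" "z \<notin> identities" "\<not> exposed (letter_supp z) w" "irreducible_word w"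
    using Cons.prems by auto
  note id = identities_iff[OF \<alpha>]
  show ?case
  proof (cases "letter_supp z = \<alpha>")
    case True
    then have zc: "z \<in> carrier (M \<alpha>)"
      using letter_suppD z by auto
    have assoc: "x \<otimes>\<^bsub>M \<alpha>\<^esub> y \<otimes>\<^bsub>M \<alpha>\<^esub> z = x \<otimes>\<^bsub>M \<alpha>\<^esub> (y \<otimes>\<^bsub>M \<alpha>\<^esub> z)"
      using x y zc by (simp add: m.m_assoc)
    have yz: "letter_supp (y \<otimes>\<^bsub>M \<alpha>\<^esub> z) = \<alpha>" "y \<otimes>\<^bsub>M \<alpha>\<^esub> z \<in> carrier (M \<alpha>)"
      using y zc letter_supp_eqI[OF \<alpha>] by auto
    show ?thesis
    proof (cases "y \<otimes>\<^bsub>M \<alpha>\<^esub> z \<in> identities")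
      case yz1: True
      then have xyz: "x \<otimes>\<^bsub>M \<alpha>\<^esub> y \<otimes>\<^bsub>M \<alpha>\<^esub> z = x"
        using assoc id[OF yz(2)] x by simp
      \<comment> \<open>Irreducibility enters here: the tail behind \<open>z\<close> has no exposed
        letter at \<alpha>, so \<open>x\<close> finds nothing to merge with.\<close>
      have sh: "shuffle (insert_letter x w) (x # w)"
        using shuffle_insert_letter_Cons z True x by simp
      show ?thesis
      proof (cases "x \<otimes>\<^bsub>M \<alpha>\<^esub> y \<in> identities")
        case xy1: True
        \<comment> \<open>Here \<open>x\<close> is a left and \<open>z\<close> a right inverse of
          \<open>y\<close>, hence they coincide.\<close>
        then have "x = z"
          using xyz id[of "x \<otimes>\<^bsub>M \<alpha>\<^esub> y"] x y zc by simp
        then show ?thesis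
          using sh yz1 xy1 True x y by (simp add: act_def)
      next
        case False
        then show ?thesis
          using sh yz1 xyz True x y xy assms(2) by (simp add: act_def)
      qed
    next
      case False
      show ?thesis
      proof (cases "x \<otimes>\<^bsub>M \<alpha>\<^esub> y \<in> identities")
        case xy1: True
        \<comment> \<open>The product \<open>x y\<close> is trivial, so the successive insertions
          must restore \<open>z\<close>.\<close>
        then have "x \<otimes>\<^bsub>M \<alpha>\<^esub> (y \<otimes>\<^bsub>M \<alpha>\<^esub> z) = z"
          using assoc id[of "x \<otimes>\<^bsub>M \<alpha>\<^esub> y"] x y zc by simp
        then show ?thesis
          using False xy1 True x y yz z by (simp add: act_def Let_def)
      next
        case xy0: False
        then show ?thesis
          using False xy0 True x y yz z xy assoc by (simp add: act_def Let_def)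
      qed
    qed
  next
    case False
    show ?thesis
    proof (cases "{\<alpha>, letter_supp z} \<in> E")
      case True
      have "shuffle (z # insert_letter x (insert_letter y w)) (z # act (x \<otimes>\<^bsub>M \<alpha>\<^esub> y) w)"
        using Cons.IH z \<alpha>_def by (auto intro: shuffle.Cons)
      then show ?thesis
        using True False x y xy by (simp add: act_def split: if_splits)
    next
      case f: False
      then show ?thesis
        using False x y xy by (simp add: act_def Let_def)
    qed
  qed
qed

lemma act_mult:
  assumes "x \<in> letters" "y \<in> letters" "letter_supp y = letter_supp x" "irreducible_word w"
  shows "shuffle (act x (act y w)) (act (x \<otimes>\<^bsub>M (letter_supp x)\<^esub> y) w)"
proof -
  interpret m: monoid "M (letter_supp x)"
    using monoids letter_suppD assms(1) by blast
  have c: "letter_supp x \<in> V" "x \<in> carrier (M (letter_supp x))" "y \<in> carrier (M (letter_supp x))"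
    using letter_suppD[OF assms(1)] letter_suppD(2)[OF assms(2)] assms(3) by auto
  consider "x \<in> identities" | "y \<in> identities" | "x \<notin> identities" "y \<notin> identities" by blast
  then show ?thesis
  proof cases
    case 1
    then have "x \<otimes>\<^bsub>M (letter_supp x)\<^esub> y = y"
      using identities_iff[OF c(1,2)] c m.l_one by metis
    then show ?thesis using 1 by (simp add: act_def)
  next
    case 2
    then have "x \<otimes>\<^bsub>M (letter_supp x)\<^esub> y = x"
      using identities_iff[OF c(1,3)] c by simp
    then show ?thesis using 2 by (simp add: act_def)
  next
    case 3
    then show ?thesis using insert_letter_mult assms by (simp add: act_def)
  qed
qed

text \<open>Neither letter obstructs the other or merges with it. The two orders can differ only
  where both letters come to rest side by side, and there a swap repairs it.\<close>

lemma insert_letter_commute: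
  assumes "x \<in> letters" "y \<in> letters" "{letter_supp x, letter_supp y} \<in> E" "w \<in> words"
  shows "shuffle (insert_letter x (insert_letter y w)) (insert_letter y (insert_letter x w))"
  using assms(4)
proof (induction w)
  case Nil
  have "letter_supp x \<noteq> letter_supp y" "{letter_supp y, letter_supp x} \<in> E"
    using assms edge_irrefl edge_sym by auto
  then show ?case using assms by (auto intro: shuffle.swap)
next
  case (Cons z w)
  have ne: "letter_supp x \<noteq> letter_supp y" and yx: "{letter_supp y, letter_supp x} \<in> E"
    using assms edge_irrefl edge_sym by auto
  have z: "z \<in> letters" "w \<in> words"
    using Cons.prems by (auto simp: words_def)
  have IH: "shuffle (z # insert_letter x (insert_letter y w)) (z # insert_letter y (insert_letter x w))"
    using Cons.IH z by (auto intro: shuffle.Cons)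
  have sw: "shuffle (x # y # z # w) (y # x # z # w)"
    using assms by (intro shuffle.swap)
  consider "letter_supp z = letter_supp x" | "letter_supp z = letter_supp y"
    | "letter_supp z \<noteq> letter_supp x" "letter_supp z \<noteq> letter_supp y" by blast
  then show ?case
  proof cases
    case 1
    then show ?thesis using ne yx assms z mult_letter(2)[of x z] by (auto simp: Let_def)
  next
    case 2
    then show ?thesis using ne yx assms z mult_letter(2)[of y z] by (auto simp: Let_def)
  next
    case 3
    then show ?thesis using ne yx assms IH sw shuffle_sym[OF sw] by auto
  qed
qed

lemma act_commute:
  assumes "x \<in> letters" "y \<in> letters" "{letter_supp x, letter_supp y} \<in> E" "w \<in> words"
  shows "shuffle (act x (act y w)) (act y (act x w))"
  using insert_letter_commute[OF assms] by (simp add: act_def)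

section \<open>The action of words and its kernel\<close>

lemma irreducible_foldr_act:
  "u \<in> words \<Longrightarrow> irreducible_word w \<Longrightarrow> irreducible_word (foldr act u w)"
  by (induction u) (auto simp: words_def irreducible_act)

lemma shuffle_foldr_act:
  "u \<in> words \<Longrightarrow> irreducible_word v \<Longrightarrow> irreducible_word w \<Longrightarrow> shuffle v w \<Longrightarrow>
   shuffle (foldr act u v) (foldr act u w)"
proof (induction u)
  case (Cons x u)
  then have "x \<in> letters" "u \<in> words"
    by (auto simp: words_def)
  then show ?case
    using Cons irreducible_imp_words irreducible_foldr_act by (simp add: shuffle_act)
qed simp

text \<open>The kernel of the action on irreducible words modulo shuffling. Once it is a congruence
  containing the relators, it contains \<open>cong_gen\<close> by minimality.\<close>

definition same_action :: "('a list \<times> 'a list) set" where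
  "same_action = {(u, v). u \<in> words \<and> v \<in> words \<and>
     (\<forall>w. irreducible_word w \<longrightarrow> shuffle (foldr act u w) (foldr act v w))}"

lemma is_congruence_same_action: "is_congruence same_action"
  unfolding is_congruence_def
proof (intro conjI allI impI)
  show "equiv words same_action"
    by (rule equivI)
      (auto simp: same_action_def intro!: refl_onI symI transI intro: shuffle_sym shuffle.trans)
next
  fix u u' v v'
  assume u: "(u, u') \<in> same_action" and v: "(v, v') \<in> same_action"
  have "shuffle (foldr act (u @ v) w) (foldr act (u' @ v') w)" if w: "irreducible_word w" for w
  proof -
    \<comment> \<open>The inner word is exchanged first, then the outer one, acting on the
      irreducible word \<open>foldr act v' w\<close>.\<close>
    have "shuffle (foldr act u (foldr act v w)) (foldr act u (foldr act v' w))"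
      using u v w by (intro shuffle_foldr_act irreducible_foldr_act) (auto simp: same_action_def)
    moreover have "shuffle (foldr act u (foldr act v' w)) (foldr act u' (foldr act v' w))"
      using u v w irreducible_foldr_act by (auto simp: same_action_def)
    ultimately show ?thesis by (auto intro: shuffle.trans)
  qed
  then show "(u @ v, u' @ v') \<in> same_action"
    using u v by (auto simp: same_action_def words_def)
qed

lemma relators_same_action: "relators \<subseteq> same_action"
proof
  fix p assume p: "p \<in> relators"
  then have pw: "p \<in> words \<times> words"
    using relators_subset by blast
  from p consider
      (one) \<alpha> where "\<alpha> \<in> V" "p = ([\<one>\<^bsub>M \<alpha>\<^esub>], [])"
    | (mult) \<alpha> x y where "\<alpha> \<in> V" "x \<in> carrier (M \<alpha>)" "y \<in> carrier (M \<alpha>)"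
        "p = ([x, y], [x \<otimes>\<^bsub>M \<alpha>\<^esub> y])"
    | (comm) \<alpha> \<beta> x y where "\<alpha> \<in> V" "\<beta> \<in> V" "{\<alpha>, \<beta>} \<in> E" "x \<in> carrier (M \<alpha>)"
        "y \<in> carrier (M \<beta>)" "p = ([x, y], [y, x])"
    unfolding relators_def by blast
  then show "p \<in> same_action"
  proof cases
    case one
    then have "\<one>\<^bsub>M \<alpha>\<^esub> \<in> identities"
      by (auto simp: identities_def)
    then show ?thesis using one pw by (simp add: same_action_def act_def)
  next
    case mult
    then have "x \<in> letters" "y \<in> letters" "letter_supp x = \<alpha>" "letter_supp y = \<alpha>"
      using lettersI letter_supp_eqI by auto
    then show ?thesis using act_mult[of x y] mult pw by (simp add: same_action_def)
  next
    case comm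
    then have "x \<in> letters" "y \<in> letters" "letter_supp x = \<alpha>" "letter_supp y = \<beta>"
      using lettersI letter_supp_eqI by auto
    then show ?thesis using act_commute[of x y] comm pw irreducible_imp_words
      by (simp add: same_action_def)
  qed
qed

lemma cong_gen_subset_same_action: "cong_gen \<subseteq> same_action"
  unfolding cong_gen_def using is_congruence_same_action relators_same_action by blast

text \<open>Each letter is inserted, up to shuffling, into a tail in which its vertex is not
  exposed, so it ends up in front. Thus the action determines the word up to shuffling.\<close>

lemma shuffle_foldr_act_Nil: "irreducible_word w \<Longrightarrow> shuffle (foldr act w []) w"
proof (induction w)
  case (Cons x w)
  then have "shuffle (act x (foldr act w [])) (act x w)"
    by (intro shuffle_act irreducible_imp_words irreducible_foldr_act) auto
  moreover have "shuffle (act x w) (x # w)"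
    using Cons.prems by (simp add: act_def shuffle_insert_letter_Cons)
  ultimately show ?case by (auto intro: shuffle.trans)
qed simp

text \<open>The normal form theorem for graph products: congruent words act alike, and evaluation at
  the empty word returns each reduced word up to shuffling.\<close>

lemma reduced_cong_gen_imp_shuffle:
  assumes "reduced u" "reduced v" "(u, v) \<in> cong_gen"
  shows "shuffle u v"
proof -
  have "shuffle (foldr act u []) (foldr act v [])"
    using assms cong_gen_subset_same_action by (auto simp: same_action_def)
  then show ?thesis
    using assms(1,2) by (meson reduced_imp_irreducible_word shuffle_foldr_act_Nil shuffle.trans shuffle_sym)
qed

section \<open>Initial letters and blocks\<close>

text \<open>The letters that begin some word of the shuffle class, that is, the minimal letters of
  the trace.\<close>

fun initial_letters :: "'a list \<Rightarrow> 'a set" where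
  "initial_letters [] = {}"
| "initial_letters (x # w) =
     insert x {y \<in> initial_letters w. {letter_supp x, letter_supp y} \<in> E}"

lemma shuffle_initial_letters: "shuffle u v \<Longrightarrow> initial_letters u = initial_letters v"
  by (induction rule: shuffle.induct) (auto simp: edge_sym)

lemma initial_letters_append:
  "initial_letters (u @ v) = initial_letters u \<union>
     {y \<in> initial_letters v. \<forall>x\<in>set u. {letter_supp x, letter_supp y} \<in> E}"
  by (induction u) auto

text \<open>Distinctness of vertices is demanded separately because \<open>supp\<close> is a set and
  forgets repetitions.\<close>

definition clique_word :: "'a list \<Rightarrow> bool" where
  "clique_word w \<longleftrightarrow> distinct (map letter_supp w) \<and> complete (supp w)"

lemma clique_word_distinct: "clique_word w \<Longrightarrow> distinct w"
  by (auto simp: clique_word_def distinct_map)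

lemma clique_word_commuting:
  "clique_word w \<Longrightarrow> x \<in> set w \<Longrightarrow> y \<in> set w \<Longrightarrow> x \<noteq> y \<Longrightarrow> {letter_supp x, letter_supp y} \<in> E"
  unfolding clique_word_def complete_def supp_def distinct_map by (metis imageI inj_onD)

lemma initial_letters_clique_word: "clique_word w \<Longrightarrow> initial_letters w = set w"
proof (induction w)
  case (Cons x w)
  then have "clique_word w"
    by (auto simp: clique_word_def complete_def supp_def)
  moreover have "{letter_supp x, letter_supp y} \<in> E" if "y \<in> set w" for y
    using clique_word_commuting[OF Cons.prems, of x y] clique_word_distinct[OF Cons.prems] that
    by auto
  ultimately show ?case using Cons.IH by auto
qed simp

text \<open>Two letters at one vertex would need an obstruction between them, but distinct vertices
  of a complete support are adjacent.\<close>

lemma reduced_complete_imp_clique_word: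
  assumes "reduced w" "complete (supp w)"
  shows "clique_word w"
proof -
  have "letter_supp (w ! i) \<noteq> letter_supp (w ! j)" if "i < j" "j < length w" for i j
    using that
  proof (induction j rule: less_induct)
    case (less j)
    show ?case
    proof
      assume "letter_supp (w ! i) = letter_supp (w ! j)"
      then obtain k where k: "i < k" "k < j" "{letter_supp (w ! i), letter_supp (w ! k)} \<notin> E"
        using assms(1) less.prems unfolding reduced_def by blast
      \<comment> \<open>A vertex is not adjacent to itself, so the obstruction could sit at the same
        vertex; the induction hypothesis for \<open>k < j\<close> excludes this.\<close>
      then have "letter_supp (w ! i) \<noteq> letter_supp (w ! k)"
        using less by simp
      then show False
        using assms(2) k less.prems unfolding complete_def supp_def by simp
    qed
  qed
  then have "distinct (map letter_supp w)"
    unfolding distinct_conv_nth by (metis length_map linorder_neqE_nat nth_map)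
  then show ?thesis using assms(2) by (simp add: clique_word_def)
qed

fun foata_blocks :: "'a list list \<Rightarrow> bool" where
  "foata_blocks [] \<longleftrightarrow> True"
| "foata_blocks (b # bs) \<longleftrightarrow> b \<noteq> [] \<and> clique_word b \<and> foata_blocks bs \<and>
     (bs \<noteq> [] \<longrightarrow> (\<forall>\<alpha>\<in>supp (hd bs). \<exists>\<beta>\<in>supp b. {\<alpha>, \<beta>} \<notin> E))"

lemma left_foata_imp_foata_blocks: "left_foata w bs \<Longrightarrow> foata_blocks bs"
proof (induction bs arbitrary: w)
  case (Cons b bs)
  have red: "reduced (b @ concat bs)" and b: "b \<noteq> []" "complete (supp b)"
    using Cons.prems unfolding left_foata_def by (auto dest!: spec[of _ 0])
  have "left_foata (concat bs) bs"
    using Cons.prems reduced_appendD2[OF red] unfolding left_foata_def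
    by (auto dest: spec[of _ "Suc _"])
  moreover have "clique_word b"
    using reduced_complete_imp_clique_word reduced_appendD1[OF red] b by blast
  moreover have "\<forall>\<alpha>\<in>supp (hd bs). \<exists>\<beta>\<in>supp b. {\<alpha>, \<beta>} \<notin> E" if "bs \<noteq> []"
  proof -
    have "\<forall>\<alpha>\<in>supp ((b # bs) ! Suc 0). \<exists>\<beta>\<in>supp ((b # bs) ! 0). {\<alpha>, \<beta>} \<notin> E"
      using Cons.prems that unfolding left_foata_def
      by (metis Suc_less_eq length_Cons length_greater_0_conv)
    then show ?thesis using that by (simp add: hd_conv_nth)
  qed
  ultimately show ?case using Cons.IH b by simp
qed simp

text \<open>By induction only letters of the second block could come to the front of the remainder,
  and each of them is blocked by some letter of the first block.\<close>

lemma initial_letters_foata_blocks: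
  "foata_blocks (b # bs) \<Longrightarrow> initial_letters (concat (b # bs)) = set b"
proof (induction bs arbitrary: b)
  case Nil
  then show ?case by (simp add: initial_letters_clique_word)
next
  case (Cons c bs)
  have "initial_letters (concat (c # bs)) = set c"
    using Cons by (intro Cons.IH) simp
  moreover have "\<exists>x\<in>set b. {letter_supp x, letter_supp y} \<notin> E" if "y \<in> set c" for y
    using Cons.prems that by (fastforce simp: supp_def edge_sym)
  moreover have "initial_letters b = set b"
    using Cons.prems by (simp add: initial_letters_clique_word)
  ultimately show ?case
    unfolding concat.simps(2)[of b] initial_letters_append by blast
qed

lemma foata_blocks_unique:
  "foata_blocks bs \<Longrightarrow> foata_blocks cs \<Longrightarrow> shuffle (concat bs) (concat cs) \<Longrightarrow>
   list_all2 shuffle bs cs"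
proof (induction bs arbitrary: cs)
  case Nil
  \<comment> \<open>Shuffling preserves length; as blocks are non-empty, \<open>cs\<close> must then
    be empty.\<close>
  then have "concat cs = []"
    using shuffle_length by force
  then show ?case using Nil.prems by (cases cs) auto
next
  case (Cons b bs)
  then have "concat cs \<noteq> []"
    using shuffle_length by force
  then obtain c cs' where cs: "cs = c # cs'"
    by (cases cs) auto
  \<comment> \<open>Both first blocks are read off as the initial letters, which shuffling
    preserves.\<close>
  have "set b = set c"
    using shuffle_initial_letters[OF Cons.prems(3)] initial_letters_foata_blocks Cons.prems(1,2) cs
    by metis
  then have bc: "shuffle b c"
    using Cons.prems(1,2) cs clique_word_distinct clique_word_commuting
    by (intro shuffle_if_commuting) auto
  \<comment> \<open>Replacing \<open>b\<close> by its shuffle \<open>c\<close> creates the common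
    prefix needed for cancellation.\<close>
  have "shuffle (c @ concat bs) (c @ concat cs')"
    using shuffle.trans[OF shuffle_append_right[OF shuffle_sym[OF bc]]] Cons.prems(3) cs by simp
  then have "shuffle (concat bs) (concat cs')"
    by (rule shuffle_append_cancel)
  then show ?case using Cons bc cs by simp
qed

end

section \<open>Uniqueness of left Foata normal forms\<close>

theorem theorem3p20:
  fixes V :: "'v set"
    and E :: "'v set set"
    and M :: "'v \<Rightarrow> ('a, 'b) monoid_scheme"
    and w u u' :: "'a list"
    and ws ws' :: "'a list list"
  assumes "graph_product V E M"
    and "w \<in> graph_product.words V M"
    and "graph_product.left_foata_of V E M w u ws"
    and "graph_product.left_foata_of V E M w u' ws'"
  shows "length ws = length ws' \<and>
    (\<forall>i<length ws. graph_product.cls V E M (ws ! i) = graph_product.cls V E M (ws' ! i))"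
proof -
  interpret graph_product V E M by fact
  have u: "left_foata u ws" "left_foata u' ws'" and cls: "cls u = cls u'"
    using assms(3,4) by (auto simp: left_foata_of_def)
  then have red: "reduced u" "reduced u'" and concat: "u = concat ws" "u' = concat ws'"
    by (auto simp: left_foata_def)
  have "(u, u') \<in> cong_gen"
    using cls red eq_equiv_class[OF _ equiv_cong_gen] unfolding cls_def reduced_def by blast
  then have all: "list_all2 shuffle ws ws'"
    using red u concat
    by (intro foata_blocks_unique left_foata_imp_foata_blocks)
      (auto intro: reduced_cong_gen_imp_shuffle)
  have "cls (ws ! i) = cls (ws' ! i)" if i: "i < length ws" for i
  proof -
    have "shuffle (ws ! i) (ws' ! i)"
      using all i by (rule list_all2_nthD)
    \<comment> \<open>Blocks inherit their letters from the reduced word \<open>u\<close>; this is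
      what lets a shuffle of blocks become an equality of classes.\<close>
    moreover have "ws ! i \<in> words"
      using red(1) concat(1) nth_mem[OF i] by (auto simp: reduced_def words_def)
    ultimately show ?thesis
      unfolding cls_def using shuffle_cong_gen equiv_class_eq[OF equiv_cong_gen] by blast
  qed
  then show ?thesis using all by (simp add: list_all2_lengthD)
qed

end
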